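(* Let $\mathbf{A}=\langle A,\lor,\land,\to,\neg,\sim,0,1\rangle$ be a finite Heyting algebra with involution. Then there is a one-to-one correspondence between the set of all involutive filters of $\mathbf{A}$ and the set of all filters of the Boolean algebra $\langle IC(A),\lor,\land,\to,\neg,0,1\rangle$.
   Context: A Heyting algebra with involution is an algebra $\langle A,\lor,\land,\to,\neg,\sim,0,1\rangle$ where $\langle A,\lor,\land,\to,\neg,0,1\rangle$ is a Heyting algebra ($a\to b=\sup\{x:a\land x\le b\}$, $\neg a=a\to 0$) and $\sim$ satisfies $\sim(a\lor b)=\sim a\land\sim b$ and $\sim\sim a=a$. A filter is a lattice filter; a filter $F$ of $\mathbf{A}$ is involutive if $a\in F$ implies $\neg\sim a\in F$. The involutive center is $IC(A)=\{a\in A:\neg a=\sim a\}$; with the operations inherited from $\mathbf{A}$ it is a Boolean algebra. *)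

theory Defs
  imports Main
begin

text \<open>
  The axiom is residuation: \<open>himp a b\<close> is the supremum of \<open>{x. a \<sqinter> x \<le> b}\<close>, and this supremum
  belongs to the set (see \<open>himp_in\<close>, \<open>himp_upper\<close>, \<open>himp_least\<close> below). Distributivity follows.
\<close>

class heyting_algebra = bounded_lattice +
  fixes himp :: "'a \<Rightarrow> 'a \<Rightarrow> 'a"
  assumes le_himp_iff: "x \<le> himp a b \<longleftrightarrow> inf a x \<le> b"
begin

definition hneg :: "'a \<Rightarrow> 'a"
  where "hneg a = himp a bot"

lemma himp_in: "himp a b \<in> {x. inf a x \<le> b}"
  using le_himp_iff by blast

lemma himp_upper: "x \<in> {x. inf a x \<le> b} \<Longrightarrow> x \<le> himp a b"
  using le_himp_iff by blast

lemma himp_least: "(\<And>x. x \<in> {x. inf a x \<le> b} \<Longrightarrow> x \<le> u) \<Longrightarrow> himp a b \<le> u"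
  using himp_in by blast

lemma le_hneg_iff: "x \<le> hneg a \<longleftrightarrow> inf a x = bot"
  by (simp add: hneg_def le_himp_iff bot_unique)

lemma inf_hneg: "inf a (hneg a) = bot"
  using le_hneg_iff by blast

lemma heyting_inf_sup: "inf x (sup y z) = sup (inf x y) (inf x z)"
proof (rule order.antisym)
  have "y \<le> himp x (sup (inf x y) (inf x z))" "z \<le> himp x (sup (inf x y) (inf x z))"
    by (simp_all add: le_himp_iff)
  then have "sup y z \<le> himp x (sup (inf x y) (inf x z))"
    by (rule sup_least)
  then show "inf x (sup y z) \<le> sup (inf x y) (inf x z)"
    by (simp add: le_himp_iff)
qed (simp add: le_infI2)

subclass distrib_lattice
  by standard (rule distrib_imp1, rule heyting_inf_sup)

lemma hneg_unique:
  assumes "inf a b = bot" "sup a b = top"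
  shows "hneg a = b"
proof (rule order.antisym)
  have "hneg a = inf (hneg a) (sup a b)"
    using assms(2) by simp
  also have "\<dots> = inf (hneg a) b"
    using inf_hneg[of a] by (simp add: heyting_inf_sup inf_commute[of "hneg a" a])
  finally show "hneg a \<le> b"
    by (metis inf.cobounded2)
  show "b \<le> hneg a"
    using assms(1) by (simp add: le_hneg_iff)
qed

end

class heyting_algebra_involution = heyting_algebra +
  fixes invol :: "'a \<Rightarrow> 'a"
  assumes invol_sup: "invol (sup a b) = inf (invol a) (invol b)"
    and invol_invol: "invol (invol a) = a"
begin

definition involutive_center :: "'a set"
  where "involutive_center = {a. hneg a = invol a}"

lemma invol_inf: "invol (inf a b) = sup (invol a) (invol b)"
  by (metis invol_sup invol_invol)

lemma invol_antimono: "a \<le> b \<Longrightarrow> invol b \<le> invol a"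
  by (metis invol_sup inf.cobounded1 sup.absorb2)

lemma invol_bot: "invol bot = top"
  by (metis invol_antimono invol_invol bot_least top_unique)

lemma invol_top: "invol top = bot"
  by (metis invol_bot invol_invol)

lemma involutive_center_iff: "a \<in> involutive_center \<longleftrightarrow> inf a (invol a) = bot"
proof
  assume "a \<in> involutive_center"
  then show "inf a (invol a) = bot"
    unfolding involutive_center_def using inf_hneg[of a] by simp
next
  assume *: "inf a (invol a) = bot"
  then have "invol (inf a (invol a)) = top"
    by (simp add: invol_bot)
  then have "sup a (invol a) = top"
    by (simp add: invol_inf invol_invol sup_commute)
  with * show "a \<in> involutive_center"
    unfolding involutive_center_def by (simp add: hneg_unique)
qed

lemma involutive_center_sup_invol: "a \<in> involutive_center \<Longrightarrow> sup a (invol a) = top"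
  by (metis involutive_center_iff invol_inf invol_invol invol_bot sup_commute)

lemma involutive_center_bot: "bot \<in> involutive_center"
  and involutive_center_top: "top \<in> involutive_center"
  by (simp_all add: involutive_center_iff invol_top)

lemma involutive_center_invol: "a \<in> involutive_center \<Longrightarrow> invol a \<in> involutive_center"
  by (simp add: involutive_center_iff invol_invol inf_commute)

lemma involutive_center_hneg: "a \<in> involutive_center \<Longrightarrow> hneg a \<in> involutive_center"
  using involutive_center_invol by (simp add: involutive_center_def)

lemma involutive_center_inf:
  assumes "a \<in> involutive_center" "b \<in> involutive_center"
  shows "inf a b \<in> involutive_center"
proof -
  have "inf (inf a b) (invol a) = inf b (inf a (invol a))"
    "inf (inf a b) (invol b) = inf a (inf b (invol b))"
    by (simp_all add: inf.assoc inf.left_commute)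
  then have "inf (inf a b) (invol a) = bot" "inf (inf a b) (invol b) = bot"
    using assms by (simp_all add: involutive_center_iff)
  then show ?thesis
    by (simp add: involutive_center_iff invol_inf heyting_inf_sup)
qed

lemma involutive_center_sup:
  assumes "a \<in> involutive_center" "b \<in> involutive_center"
  shows "sup a b \<in> involutive_center"
  using involutive_center_invol[OF involutive_center_inf[OF
      involutive_center_invol[OF assms(1)] involutive_center_invol[OF assms(2)]]]
  by (simp add: invol_inf invol_invol)

lemma involutive_center_himp_eq:
  assumes "a \<in> involutive_center"
  shows "himp a b = sup (hneg a) b"
proof (rule order.antisym)
  have "himp a b = inf (himp a b) (sup a (hneg a))"
    using involutive_center_sup_invol[OF assms] assms by (simp add: involutive_center_def)
  also have "\<dots> = sup (inf a (himp a b)) (inf (himp a b) (hneg a))"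
    by (simp add: heyting_inf_sup inf_commute)
  also have "\<dots> \<le> sup (hneg a) b"
    using himp_in[of a b] by (auto intro: le_supI1 le_supI2)
  finally show "himp a b \<le> sup (hneg a) b" .
  show "sup (hneg a) b \<le> himp a b"
    by (simp add: le_himp_iff heyting_inf_sup inf_hneg)
qed

lemma involutive_center_himp:
  "a \<in> involutive_center \<Longrightarrow> b \<in> involutive_center \<Longrightarrow> himp a b \<in> involutive_center"
  by (simp add: involutive_center_himp_eq involutive_center_sup involutive_center_hneg)

end

text \<open>The involutive center as an algebra in its own right, with the inherited operations.\<close>

typedef (overloaded) 'a ic = "involutive_center :: 'a::heyting_algebra_involution set"
  morphisms of_ic to_ic
  using involutive_center_bot by blast

setup_lifting type_definition_ic

instantiation ic :: (heyting_algebra_involution) heyting_algebra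
begin

lift_definition sup_ic :: "'a ic \<Rightarrow> 'a ic \<Rightarrow> 'a ic" is sup by (rule involutive_center_sup)
lift_definition inf_ic :: "'a ic \<Rightarrow> 'a ic \<Rightarrow> 'a ic" is inf by (rule involutive_center_inf)
lift_definition himp_ic :: "'a ic \<Rightarrow> 'a ic \<Rightarrow> 'a ic" is himp by (rule involutive_center_himp)
lift_definition bot_ic :: "'a ic" is bot by (rule involutive_center_bot)
lift_definition top_ic :: "'a ic" is top by (rule involutive_center_top)
lift_definition less_eq_ic :: "'a ic \<Rightarrow> 'a ic \<Rightarrow> bool" is "(\<le>)" .
lift_definition less_ic :: "'a ic \<Rightarrow> 'a ic \<Rightarrow> bool" is "(<)" .

instance
  by standard (transfer; auto simp: less_le_not_le le_himp_iff intro: order.trans)+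

end

instantiation ic :: (heyting_algebra_involution) boolean_algebra
begin

lift_definition uminus_ic :: "'a ic \<Rightarrow> 'a ic" is hneg by (rule involutive_center_hneg)

definition minus_ic :: "'a ic \<Rightarrow> 'a ic \<Rightarrow> 'a ic"
  where "minus_ic x y = inf x (- y)"

instance
proof
  fix x y :: "'a ic"
  show "inf x (- x) = bot"
    by transfer (rule inf_hneg)
  show "sup x (- x) = top"
    by transfer (use involutive_center_sup_invol in \<open>auto simp: involutive_center_def\<close>)
  show "x - y = inf x (- y)"
    by (rule minus_ic_def)
qed

end

lemma hneg_ic_eq: "hneg x = - x"
  and himp_ic_eq: "himp x y = sup (- x) y"
  for x y :: "'a::heyting_algebra_involution ic"
proof -
  show "hneg x = - x"
    by (rule hneg_unique) simp_all
  show "himp x y = sup (- x) y"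
    by transfer (rule involutive_center_himp_eq)
qed

text \<open>Filters are nonempty; the improper filter is included.\<close>

definition lattice_filter :: "'a::lattice set \<Rightarrow> bool"
  where "lattice_filter F \<longleftrightarrow>
    F \<noteq> {} \<and> (\<forall>a\<in>F. \<forall>b\<in>F. inf a b \<in> F) \<and> (\<forall>a\<in>F. \<forall>b. a \<le> b \<longrightarrow> b \<in> F)"

definition involutive_filter :: "'a::heyting_algebra_involution set \<Rightarrow> bool"
  where "involutive_filter F \<longleftrightarrow> lattice_filter F \<and> (\<forall>a\<in>F. hneg (invol a) \<in> F)"

end

theory Submission imports Defs begin

text \<open>
  A filter of a finite lattice has a least element \<open>m\<close>. If the filter is involutive then
  \<open>m \<le> \<not>\<sim>m\<close>, that is \<open>m \<and> \<sim>m = 0\<close>, so \<open>m\<close> lies in the involutive center. Hence an involutive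
  filter is generated by its trace on the center. Conversely, the up-closure of a filter of the
  center is involutive, because \<open>\<not>\<sim>g = g\<close> for central \<open>g\<close>.
\<close>

lemma lattice_filter_infD: "lattice_filter F \<Longrightarrow> a \<in> F \<Longrightarrow> b \<in> F \<Longrightarrow> inf a b \<in> F"
  by (simp add: lattice_filter_def)

lemma lattice_filter_upD: "lattice_filter F \<Longrightarrow> a \<in> F \<Longrightarrow> a \<le> b \<Longrightarrow> b \<in> F"
  by (auto simp: lattice_filter_def)

lemma lattice_filter_top:
  fixes F :: "'a::bounded_lattice set"
  shows "lattice_filter F \<Longrightarrow> top \<in> F"
  by (metis lattice_filter_def ex_in_conv top_greatest)

text \<open>Quantifying over finite subsets \<open>S\<close> of \<open>F\<close> lets the induction
  run, since the subsets it passes through need not be filters. Taking \<open>S = F\<close> for a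
  finite filter gives its least element.\<close>

lemma lattice_filter_lower_bound:
  assumes F: "lattice_filter F" and "finite S" "S \<subseteq> F"
  shows "\<exists>m\<in>F. \<forall>a\<in>S. m \<le> a"
  using assms(2,3)
proof (induction S rule: finite_induct)
  case empty
  then show ?case
    using F by (auto simp: lattice_filter_def)
next
  case (insert x S)
  then obtain m where "m \<in> F" "\<forall>a\<in>S. m \<le> a"
    by auto
  then have "inf x m \<in> F" "\<forall>a\<in>insert x S. inf x m \<le> a"
    using F insert.prems by (auto simp: lattice_filter_infD intro: le_infI2)
  then show ?case
    by blast
qed

lemma of_ic_central: "inf (of_ic g) (invol (of_ic g)) = bot"
  using of_ic[of g] by (simp add: involutive_center_iff)

lemma involutive_filter_central_lower_bound:
  fixes F :: "'a::heyting_algebra_involution set"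
  assumes F: "involutive_filter F" and "finite F"
  shows "\<exists>g. of_ic g \<in> F \<and> (\<forall>a\<in>F. of_ic g \<le> a)"
proof -
  obtain m where m: "m \<in> F" "\<forall>a\<in>F. m \<le> a"
    using lattice_filter_lower_bound[of F F] assms by (auto simp: involutive_filter_def)
  \<comment> \<open>Involutivity puts \<open>hneg (invol m)\<close> in \<open>F\<close>, and
    \<open>m\<close> is below every member of \<open>F\<close>.\<close>
  then have "m \<le> hneg (invol m)"
    using F by (simp add: involutive_filter_def)
  then have "m \<in> involutive_center"
    by (simp add: le_hneg_iff involutive_center_iff inf_commute)
  then show ?thesis
    using m by (intro exI[of _ "to_ic m"]) (simp add: to_ic_inverse)
qed

lemma lattice_filter_ic_trace:
  fixes F :: "'a::heyting_algebra_involution set"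
  assumes "lattice_filter F"
  shows "lattice_filter (of_ic -` F)"
  unfolding lattice_filter_def
proof (intro conjI ballI allI impI)
  have "top \<in> of_ic -` F"
    using lattice_filter_top[OF assms] by (simp add: top_ic.rep_eq)
  then show "of_ic -` F \<noteq> {}"
    by blast
next
  fix a b
  assume "a \<in> of_ic -` F" "b \<in> of_ic -` F"
  then show "inf a b \<in> of_ic -` F"
    using assms by (simp add: inf_ic.rep_eq lattice_filter_infD)
next
  fix a b :: "'a ic"
  assume "a \<in> of_ic -` F" "a \<le> b"
  then show "b \<in> of_ic -` F"
    using assms by (auto simp: less_eq_ic.rep_eq intro: lattice_filter_upD)
qed

text \<open>The upward closure is taken in the whole algebra; it will be the inverse of the trace
  map \<open>vimage of_ic\<close>.\<close>

definition ic_upclosure :: "'a::heyting_algebra_involution ic set \<Rightarrow> 'a set"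
  where "ic_upclosure G = {a. \<exists>g\<in>G. of_ic g \<le> a}"

lemma involutive_filter_ic_upclosure:
  assumes G: "lattice_filter G"
  shows "involutive_filter (ic_upclosure G)"
  unfolding involutive_filter_def lattice_filter_def
proof (intro conjI ballI allI impI)
  show "ic_upclosure G \<noteq> {}"
    using G by (auto simp: lattice_filter_def ic_upclosure_def)
next
  fix a b
  assume "a \<in> ic_upclosure G" "b \<in> ic_upclosure G"
  then obtain g h where gh: "g \<in> G" "h \<in> G" "of_ic g \<le> a" "of_ic h \<le> b"
    by (auto simp: ic_upclosure_def)
  then have "inf g h \<in> G" "of_ic (inf g h) \<le> inf a b"
    using G by (auto simp: lattice_filter_infD inf_ic.rep_eq intro: le_infI1 le_infI2)
  then show "inf a b \<in> ic_upclosure G"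
    by (auto simp: ic_upclosure_def)
next
  fix a b
  assume "a \<in> ic_upclosure G" "a \<le> b"
  then show "b \<in> ic_upclosure G"
    by (auto simp: ic_upclosure_def intro: order.trans)
next
  fix a
  assume "a \<in> ic_upclosure G"
  then obtain g where g: "g \<in> G" "of_ic g \<le> a"
    by (auto simp: ic_upclosure_def)
  \<comment> \<open>As \<open>invol\<close> reverses the order, \<open>invol a\<close> is below
    \<open>invol (of_ic g)\<close>, which meets \<open>of_ic g\<close> in \<open>bot\<close>. So the
    same \<open>g\<close> that witnesses membership of \<open>a\<close> also witnesses that of
    \<open>hneg (invol a)\<close>.\<close>
  have "inf (invol a) (of_ic g) \<le> inf (of_ic g) (invol (of_ic g))"
    using invol_antimono[OF g(2)] by (simp add: le_infI1)
  then have "of_ic g \<le> hneg (invol a)"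
    by (simp add: of_ic_central le_hneg_iff bot_unique)
  then show "hneg (invol a) \<in> ic_upclosure G"
    using g(1) by (auto simp: ic_upclosure_def)
qed

text \<open>The order of the center is the restricted one, so a central element above a member of
  \<open>G\<close> is already in \<open>G\<close>.\<close>

lemma ic_trace_upclosure:
  assumes "lattice_filter G"
  shows "of_ic -` ic_upclosure G = G"
  using lattice_filter_upD[OF assms]
  by (auto simp: ic_upclosure_def simp flip: less_eq_ic.rep_eq)

text \<open>Finiteness enters here: it provides one central element of \<open>F\<close> below all of
  \<open>F\<close>, which witnesses the inclusion from right to left.\<close>

lemma ic_upclosure_trace:
  assumes "involutive_filter F" and "finite F"
  shows "ic_upclosure (of_ic -` F) = F"
proof
  show "ic_upclosure (of_ic -` F) \<subseteq> F"
    using assms(1) by (auto simp: ic_upclosure_def involutive_filter_def intro: lattice_filter_upD)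
  show "F \<subseteq> ic_upclosure (of_ic -` F)"
    using involutive_filter_central_lower_bound[OF assms] by (auto simp: ic_upclosure_def)
qed

theorem theorem3p4:
  shows "\<exists>\<phi> :: 'a::{finite, heyting_algebra_involution} set \<Rightarrow> 'a ic set.
    bij_betw \<phi> {F. involutive_filter F} {G. lattice_filter G}"
proof
  \<comment> \<open>The correspondence sends \<open>F\<close> to its trace on the center; the class
    \<open>finite\<close> makes every \<open>F\<close> finite.\<close>
  show "bij_betw (vimage of_ic) {F :: 'a set. involutive_filter F} {G. lattice_filter G}"
    by (rule bij_betw_byWitness[where f' = ic_upclosure])
      (auto simp: ic_upclosure_trace ic_trace_upclosure involutive_filter_ic_upclosure
        involutive_filter_def[THEN iffD1] lattice_filter_ic_trace)
qed

end
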